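(* For all integers $r,k\ge1$ and all complex $s$ with $\Re s>1$, \begin{align*} \psi(\underbrace{1,\ldots,1}_{r-1},k;s)&=(-1)^{k-1}\sum_{\substack{a_1,\ldots,a_k\ge 0\\ a_1+\cdots+a_k=r}}\binom{s+a_k-1}{a_k}\,T(a_1+1,\ldots,a_{k-1}+1,a_k+s)\\ &\quad+\sum_{j=0}^{k-2}(-1)^j\,T(\underbrace{1,\ldots,1}_{r-1},k-j)\,T(\underbrace{1,\ldots,1}_{j},s). \end{align*}
   Context: For integers $k_1,\ldots,k_r$ and $|z|<1$, $\mathrm{Ath}(k_1,\ldots,k_r;z)=\sum_{0<m_1<\cdots<m_r,\ m_i\equiv i \bmod 2}\frac{z^{m_r}}{m_1^{k_1}\cdots m_r^{k_r}}$ (summation variables alternately odd, even, odd, \ldots). For positive integers $k_1,\ldots,k_{r-1}$ and complex $s$ (with convergence, e.g. $\Re s>1$), let \[T_0(k_1,\ldots,k_{r-1},s)=\sum_{\substack{0<m_1<\cdots<m_r\\ m_i\equiv i\bmod 2}}\frac{1}{m_1^{k_1}\cdots m_{r-1}^{k_{r-1}}m_r^{s}},\qquad T(k_1,\ldots,k_{r-1},s)=2^{r}\,T_0(k_1,\ldots,k_{r-1},s),\] where $r$ is the total number of arguments; in particular $T(s)=2\sum_{n\ge0}(2n+1)^{-s}$, and $T$ at integer arguments with last argument $\ge2$ is a convergent number. For positive integers $k_1,\ldots,k_r$ and $\Re s>0$, \[\psi(k_1,\ldots,k_r;s)=\frac{2^r}{\Gamma(s)}\int_0^\infty t^{s-1}\frac{\mathrm{Ath}(k_1,\ldots,k_r;\tanh(t/2))}{\sinh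 t}\,dt,\] which extends to an entire function of $s$. $\binom{s+a-1}{a}=\frac{s(s+1)\cdots(s+a-1)}{a!}$. *)

theory Defs
  imports "HOL-Analysis.Analysis"
begin

text \<open>
  The tuples \<open>0 < m\<^sub>1 < \<dots> < m\<^sub>r\<close> with \<open>m\<^sub>i \<equiv> i (mod 2)\<close>, encoded as lists of length \<open>r\<close>.
  List positions count from 0, so \<open>m\<^sub>i\<close> is \<open>ms ! (i - 1)\<close>.
\<close>

definition alt_tuples :: "nat \<Rightarrow> nat list set" where
  "alt_tuples r = {ms. length ms = r \<and> sorted_wrt (<) ms \<and>
     (\<forall>i<r. 0 < ms ! i \<and> ms ! i mod 2 = (i + 1) mod 2)}"

text \<open>
  Only used for nonempty \<open>ks\<close> and \<open>norm z < 1\<close>, where the series converges absolutely.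
\<close>

definition Ath :: "int list \<Rightarrow> complex \<Rightarrow> complex" where
  "Ath ks z = (\<Sum>\<^sub>\<infinity>ms\<in>alt_tuples (length ks).
     z ^ last ms / (\<Prod>i<length ks. of_nat (ms ! i) powi (ks ! i)))"

text \<open>
  The list \<open>ks\<close> holds all arguments but the last, so the depth \<open>r\<close> is \<open>length ks + 1\<close>
  and \<open>T [] s\<close> is the one-argument function \<open>T(s)\<close>. The series converges absolutely
  for positive \<open>ks\<close> and \<open>Re s > 1\<close>.
\<close>

definition T0 :: "nat list \<Rightarrow> complex \<Rightarrow> complex" where
  "T0 ks s = (\<Sum>\<^sub>\<infinity>ms\<in>alt_tuples (length ks + 1).
     1 / ((\<Prod>i<length ks. of_nat (ms ! i) ^ (ks ! i)) * of_nat (last ms) powr s))"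

definition T :: "nat list \<Rightarrow> complex \<Rightarrow> complex" where
  "T ks s = 2 ^ (length ks + 1) * T0 ks s"

text \<open>
  Only used in the half-plane \<open>Re s > 0\<close>, where the integral converges absolutely.
\<close>

definition psi :: "nat list \<Rightarrow> complex \<Rightarrow> complex" where
  "psi ks s = 2 ^ length ks / Gamma s *
     (LBINT t:{0<..}. of_real t powr (s - 1) *
        (Ath (map int ks) (of_real (tanh (t / 2))) / of_real (sinh t)))"

end

theory Submission
  imports Defs
begin

text \<open>
  Put \<open>F\<^sub>k(t) = Ath(1,\<dots>,1,k; tanh(t/2))\<close>. Then \<open>F\<^sub>1(t) = (t/2)\<^sup>r / r!\<close> and
  \<open>F\<^sub>k\<^sub>+\<^sub>1' = F\<^sub>k / sinh\<close>, with \<open>F\<^sub>k(t)\<close> tending to \<open>T\<^sub>0(1,\<dots>,1,k)\<close> at infinity for \<open>k \<ge> 2\<close>.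
  The functions \<open>2\<^sup>j Ath(1,\<dots>,1; e\<^sup>-\<^sup>t)\<close> of depth \<open>j\<close>, and the sums over compositions of \<open>r\<close> of
  \<open>2\<^sup>k\<^sup>-\<^sup>1 t\<^sup>c / c! Ath(a\<^sub>1 + 1, \<dots>, a\<^sub>k\<^sub>-\<^sub>1 + 1; e\<^sup>-\<^sup>t)\<close> with last part \<open>c\<close>, satisfy the same recursion up to sign
  and vanish at infinity. Comparing derivatives and limits expresses \<open>F\<^sub>k\<close> pointwise
  through them, so the iterated integrals in the usual argument are not needed. Finally the Mellin
  transform of \<open>Ath(\<dots>; e\<^sup>-\<^sup>t) / sinh t\<close> is a multiple of \<open>T\<^sub>0\<close>, term by term.
\<close>

section \<open>Coefficients of the alternating series\<close>

text \<open>The argument lists of \<open>ath_coeff\<close> are reversed: the head is the exponent of the largest variable.\<close>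

fun ath_coeff :: "nat list \<Rightarrow> nat \<Rightarrow> real" where
  "ath_coeff [] n = (if n = 0 then 1 else 0)"
| "ath_coeff (k # ks) n =
     (if odd (n + length ks) then \<Sum>m<n. ath_coeff ks m else 0) / real n ^ k"

text \<open>The coefficient before division by the outermost power of \<open>n\<close>. It is kept
  apart so that the last exponent can be complex in \<open>T0\<close>; it is also the coefficient of
  \<open>x / (1 - x^2)\<close> times the series of \<open>ks\<close>.\<close>

definition alt_psum :: "nat list \<Rightarrow> nat \<Rightarrow> real" where
  "alt_psum ks n = (if odd (n + length ks) then \<Sum>m<n. ath_coeff ks m else 0)"

lemma ath_coeff_Cons: "ath_coeff (k # ks) n = alt_psum ks n / real n ^ k"
  by (simp add: alt_psum_def)

declare ath_coeff.simps(2) [simp del]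

lemma alt_psum_0 [simp]: "alt_psum ks 0 = 0"
  by (simp add: alt_psum_def)

lemma ath_coeff_0: "ath_coeff ks 0 = (if ks = [] then 1 else 0)"
  by (cases ks) (simp_all add: ath_coeff_Cons)

lemma ath_coeff_nonneg: "0 \<le> ath_coeff ks n"
  by (induction ks arbitrary: n) (simp_all add: ath_coeff_Cons alt_psum_def sum_nonneg)

lemma alt_psum_nonneg: "0 \<le> alt_psum ks n"
  by (simp add: alt_psum_def sum_nonneg ath_coeff_nonneg)

lemma alt_psum_le_sum: "alt_psum ks n \<le> (\<Sum>m<n. ath_coeff ks m)"
  by (simp add: alt_psum_def sum_nonneg ath_coeff_nonneg)

lemma ath_coeff_parity: "odd (n + length ks) \<Longrightarrow> ath_coeff ks n = 0"
  by (cases ks) (auto simp: ath_coeff_Cons alt_psum_def intro: Nat.gr0I)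

text \<open>There are \<open>n\<close> smaller indices, each contributing at most 1 by induction,
  against a denominator of at least \<open>n\<close>. This crude bound gives a geometric majorant
  for \<open>\<bar>x\<bar> < 1\<close>.\<close>

lemma ath_coeff_le_1:
  assumes "\<forall>k\<in>set ks. k \<ge> 1"
  shows "ath_coeff ks n \<le> 1"
  using assms
proof (induction ks arbitrary: n)
  case (Cons k ks)
  show ?case
  proof (cases "n = 0")
    case False
    have "alt_psum ks n \<le> (\<Sum>m<n. 1)"
      by (rule order_trans[OF alt_psum_le_sum], intro sum_mono Cons.IH) (use Cons.prems in auto)
    also have "(\<Sum>m<n. 1) \<le> real n ^ k"
      using False Cons.prems self_le_power[of "real n" k] by simp
    finally show ?thesis
      using False by (simp add: ath_coeff_Cons)
  qed (simp add: ath_coeff_Cons)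
qed simp

text \<open>If \<open>n + length ks\<close> is odd, the range of summation gains \<open>n\<close>
  and \<open>Suc n\<close>, and parity kills the term at \<open>n\<close>; otherwise every term is
  0. This two-step recurrence is the source of the factor \<open>1 / (1 - x^2)\<close>.\<close>

lemma alt_psum_Suc_Suc: "alt_psum ks (Suc (Suc n)) = alt_psum ks n + ath_coeff ks (Suc n)"
  by (auto simp: alt_psum_def intro!: ath_coeff_parity)

section \<open>Growth of the partial sums and convergence of the series for
  \<open>T0\<close>\<close>

text \<open>Half of the exponent is spent on the inner sum: the term at \<open>m\<close> is at most
  \<open>C * m powr (e/2 - 1)\<close>, which is \<open>C * m powr e\<close> times the summable
  \<open>m powr (- 1 - e/2)\<close>, and \<open>m powr e\<close> is at most
  \<open>n powr e\<close>.\<close>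

lemma sum_ath_coeff_powr_bound:
  assumes "\<forall>k\<in>set ks. k \<ge> 1" "e > 0"
  shows "\<exists>C\<ge>0. \<forall>n\<ge>1. (\<Sum>m<n. ath_coeff ks m) \<le> C * real n powr e"
  using assms
proof (induction ks arbitrary: e)
  case Nil
  have "(\<Sum>m<n. ath_coeff [] m) \<le> 1 * real n powr e" if "n \<ge> 1" for n :: nat
    using that Nil.prems by (simp add: sum.delta' ge_one_powr_ge_zero)
  then show ?case by (intro exI[of _ 1]) auto
next
  case (Cons k ks)
  then obtain C where C: "C \<ge> 0" "\<And>n. n \<ge> 1 \<Longrightarrow> (\<Sum>m<n. ath_coeff ks m) \<le> C * real n powr (e/2)"
    by (metis half_gt_zero list.set_intros(2))
  define Z where "Z = (\<Sum>m. real m powr (- 1 - e/2))"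
  have Z: "summable (\<lambda>m. real m powr (- 1 - e/2))"
    using Cons.prems by (subst summable_real_powr_iff) auto
  have "(\<Sum>m<n. ath_coeff (k # ks) m) \<le> C * Z * real n powr e" if "n \<ge> 1" for n :: nat
  proof -
    have "(\<Sum>m<n. ath_coeff (k # ks) m) \<le> (\<Sum>m<n. C * real n powr e * real m powr (- 1 - e/2))"
    proof (intro sum_mono)
      fix m assume m: "m \<in> {..<n}"
      show "ath_coeff (k # ks) m \<le> C * real n powr e * real m powr (- 1 - e/2)"
      proof (cases "m = 0")
        case False
        have "ath_coeff (k # ks) m \<le> (C * real m powr (e/2)) / real m ^ 1"
          unfolding ath_coeff_Cons
          using False Cons.prems C
          by (intro frac_le order_trans[OF alt_psum_le_sum] power_increasing) auto
        also have "\<dots> = C * (real m powr e * real m powr (- 1 - e/2))"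
        proof -
          have "real m powr e * real m powr (- 1 - e/2) = real m powr (e/2 - 1)"
            by (simp add: powr_add[symmetric])
          also have "\<dots> = real m powr (e/2) / real m"
            using False by (simp add: powr_diff)
          finally show ?thesis by simp
        qed
        also have "\<dots> \<le> C * (real n powr e * real m powr (- 1 - e/2))"
          using m C Cons.prems by (intro mult_left_mono mult_right_mono powr_mono2) auto
        finally show ?thesis by (simp add: mult_ac)
      qed (use C in \<open>simp add: ath_coeff_Cons\<close>)
    qed
    also have "\<dots> = C * real n powr e * (\<Sum>m<n. real m powr (- 1 - e/2))"
      by (simp add: sum_distrib_left)
    also have "\<dots> \<le> C * real n powr e * Z"
      unfolding Z_def using C Z by (intro mult_left_mono sum_le_suminf) auto
    finally show ?thesis by (simp add: mult_ac)
  qed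
  moreover have "Z \<ge> 0" unfolding Z_def by (intro suminf_nonneg Z) auto
  ultimately show ?case using C by (intro exI[of _ "C * Z"]) auto
qed

lemma summable_alt_psum_powr:
  assumes "\<forall>k\<in>set ks. k \<ge> 1" "x > 1"
  shows "summable (\<lambda>n. alt_psum ks n * real n powr (- x))"
proof -
  \<comment> \<open>Any positive \<open>e\<close> below \<open>x - 1\<close> would do: it keeps the
    exponent \<open>e - x\<close> below \<open>- 1\<close>.\<close>
  define e where "e = (x - 1) / 2"
  have e: "e > 0" using assms by (simp add: e_def)
  obtain C where C: "C \<ge> 0" "\<And>n. n \<ge> 1 \<Longrightarrow> (\<Sum>m<n. ath_coeff ks m) \<le> C * real n powr e"
    using sum_ath_coeff_powr_bound[OF assms(1) e] by blast
  show ?thesis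
  proof (rule summable_comparison_test')
    show "summable (\<lambda>n. C * real n powr (e - x))"
      using assms by (intro summable_mult) (simp add: summable_real_powr_iff e_def field_simps)
    show "norm (alt_psum ks n * real n powr (- x)) \<le> C * real n powr (e - x)" if "n \<ge> 1" for n
    proof -
      have "alt_psum ks n * real n powr (- x) \<le> C * real n powr e * real n powr (- x)"
        using that C by (intro mult_right_mono order_trans[OF alt_psum_le_sum]) auto
      also have "\<dots> = C * real n powr (e - x)"
        by (simp add: powr_diff powr_minus field_simps)
      finally show ?thesis by (simp add: alt_psum_nonneg)
    qed
  qed
qed

section \<open>Grouping tuples by their last entry\<close>

text \<open>The case distinction avoids the junk value \<open>last []\<close>; the empty tuple counts as ending in \<open>0\<close>.\<close>

definition alt_tuples_ending :: "nat \<Rightarrow> nat \<Rightarrow> nat list set" where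
  "alt_tuples_ending r n = {ms \<in> alt_tuples r. (if ms = [] then 0 else last ms) = n}"

lemma alt_tuples_0: "alt_tuples 0 = {[]}"
  by (auto simp: alt_tuples_def)

text \<open>In an increasing list only the last entry has to be compared with the new one. Reading
  it as 0 for the empty list absorbs the positivity condition.\<close>

lemma snoc_in_alt_tuples_iff:
  "ms @ [n] \<in> alt_tuples (Suc r) \<longleftrightarrow>
     ms \<in> alt_tuples r \<and> odd (n + r) \<and> (if ms = [] then 0 else last ms) < n"
proof -
  have parity: "n mod 2 = (r + 1) mod 2 \<longleftrightarrow> odd (n + r)"
    by presburger
  have last: "(\<forall>x\<in>set ms. x < n) \<and> 0 < n \<longleftrightarrow> (if ms = [] then 0 else last ms) < n"
    if "sorted_wrt (<) ms"
    using that by (cases ms rule: rev_cases) (auto simp: sorted_wrt_append)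
  have elems: "(\<forall>i<Suc (length ms). 0 < (ms @ [n]) ! i \<and> (ms @ [n]) ! i mod 2 = (i + 1) mod 2) \<longleftrightarrow>
      (\<forall>i<length ms. 0 < ms ! i \<and> ms ! i mod 2 = (i + 1) mod 2) \<and>
      0 < n \<and> n mod 2 = (length ms + 1) mod 2"
    unfolding All_less_Suc by (simp add: nth_append conj_commute)
  show ?thesis
  proof (cases "length ms = r \<and> sorted_wrt (<) ms")
    case True
    then have "ms @ [n] \<in> alt_tuples (Suc r) \<longleftrightarrow>
        ms \<in> alt_tuples r \<and> n mod 2 = (r + 1) mod 2 \<and> (\<forall>x\<in>set ms. x < n) \<and> 0 < n"
      using elems by (simp add: alt_tuples_def sorted_wrt_append) blast
    then show ?thesis
      using True parity last by simp
  qed (auto simp: alt_tuples_def sorted_wrt_append)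
qed

lemma alt_tuples_ending_Suc:
  "alt_tuples_ending (Suc r) n =
     (if odd (n + r) then \<Union>m<n. (\<lambda>ms. ms @ [n]) ` alt_tuples_ending r m else {})"
  (is "?L = ?R")
proof (intro set_eqI)
  fix xs :: "nat list"
  show "xs \<in> ?L \<longleftrightarrow> xs \<in> ?R"
  proof (cases xs rule: rev_cases)
    case Nil
    then show ?thesis by (auto simp: alt_tuples_ending_def alt_tuples_def)
  next
    case (snoc ms l)
    then show ?thesis
      by (auto simp: alt_tuples_ending_def snoc_in_alt_tuples_iff image_iff)
  qed
qed

lemma finite_alt_tuples_ending: "finite (alt_tuples_ending r n)"
proof (induction r arbitrary: n)
  case 0
  then show ?case by (simp add: alt_tuples_ending_def alt_tuples_0)
qed (simp add: alt_tuples_ending_Suc)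

lemma alt_tuples_length: "ms \<in> alt_tuples r \<Longrightarrow> length ms = r"
  by (simp add: alt_tuples_def)

lemma disjoint_alt_tuples_ending: "m \<noteq> n \<Longrightarrow> alt_tuples_ending r m \<inter> alt_tuples_ending r n = {}"
  by (auto simp: alt_tuples_ending_def)

lemma sum_alt_tuples_ending_Suc:
  "sum f (alt_tuples_ending (Suc r) n) =
     (if odd (n + r) then \<Sum>m<n. \<Sum>ms\<in>alt_tuples_ending r m. f (ms @ [n]) else 0)"
proof -
  have "sum f (\<Union>m<n. (\<lambda>ms. ms @ [n]) ` alt_tuples_ending r m) =
          (\<Sum>m<n. sum f ((\<lambda>ms. ms @ [n]) ` alt_tuples_ending r m))"
    by (rule sum.UNION_disjoint)
      (use disjoint_alt_tuples_ending in \<open>fastforce simp: finite_alt_tuples_ending\<close>)+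
  also have "\<dots> = (\<Sum>m<n. \<Sum>ms\<in>alt_tuples_ending r m. f (ms @ [n]))"
    by (rule sum.cong[OF refl], subst sum.reindex) (auto simp: inj_on_def)
  finally show ?thesis by (simp add: alt_tuples_ending_Suc)
qed

text \<open>Stripping the largest entry of a tuple mirrors the recursion of
  \<open>ath_coeff\<close>. This links the index sets of the definitions to ordinary series
  coefficients.\<close>

lemma sum_alt_tuples_ending_eq_ath_coeff:
  "(\<Sum>ms\<in>alt_tuples_ending (length ks) n. 1 / (\<Prod>i<length ks. real (ms ! i) ^ (ks ! i))) =
     ath_coeff (rev ks) n"
proof (induction ks arbitrary: n rule: rev_induct)
  case Nil
  have "alt_tuples_ending 0 n = (if n = 0 then {[]} else {})"
    by (auto simp: alt_tuples_ending_def alt_tuples_0)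
  then show ?case by simp
next
  case (snoc k ks)
  have *: "(\<Prod>i<length (ks @ [k]). real ((ms @ [n]) ! i) ^ ((ks @ [k]) ! i)) =
           (\<Prod>i<length ks. real (ms ! i) ^ (ks ! i)) * real n ^ k"
    if "ms \<in> alt_tuples_ending (length ks) m" for ms m
  proof -
    have [simp]: "length ms = length ks"
      using that by (simp add: alt_tuples_ending_def alt_tuples_length)
    have "(\<Prod>i<length ks. real ((ms @ [n]) ! i) ^ ((ks @ [k]) ! i)) =
            (\<Prod>i<length ks. real (ms ! i) ^ (ks ! i))"
      by (intro prod.cong) (auto simp: nth_append)
    then show ?thesis by (simp add: nth_append)
  qed
  have "(\<Sum>ms\<in>alt_tuples_ending (length (ks @ [k])) n.
           1 / (\<Prod>i<length (ks @ [k]). real (ms ! i) ^ ((ks @ [k]) ! i))) =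
        (if odd (n + length ks) then \<Sum>m<n. \<Sum>ms\<in>alt_tuples_ending (length ks) m.
            1 / (\<Prod>i<length (ks @ [k]). real ((ms @ [n]) ! i) ^ ((ks @ [k]) ! i)) else 0)"
    by (simp only: length_append_singleton sum_alt_tuples_ending_Suc)
  also have "\<dots> = (if odd (n + length ks) then \<Sum>m<n. \<Sum>ms\<in>alt_tuples_ending (length ks) m.
            1 / (\<Prod>i<length ks. real (ms ! i) ^ (ks ! i)) / real n ^ k else 0)"
    by (intro if_cong sum.cong refl) (simp add: * del: length_append)
  also have "\<dots> = ath_coeff (rev (ks @ [k])) n"
    unfolding sum_divide_distrib[symmetric] snoc.IH
    by (simp add: ath_coeff_Cons alt_psum_def)
  finally show ?case .
qed

text \<open>Fixing the last entry leaves finite fibres, so absolute convergence turns the unordered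
  sum into a series over \<open>n\<close>. The factor \<open>f\<close> stays arbitrary in order to
  serve both \<open>T0\<close> with a complex exponent and \<open>Ath\<close>.\<close>

lemma infsum_alt_tuples_Suc:
  fixes f :: "nat \<Rightarrow> complex"
  assumes summ: "summable (\<lambda>n. alt_psum (rev ks) n * norm (f n))"
  shows "(\<Sum>\<^sub>\<infinity>ms\<in>alt_tuples (Suc (length ks)).
            f (last ms) / of_real (\<Prod>i<length ks. real (ms ! i) ^ (ks ! i))) =
         (\<Sum>n. of_real (alt_psum (rev ks) n) * f n)"
proof -
  let ?r = "length ks"
  define w where "w ms = (\<Prod>i<?r. real (ms ! i) ^ (ks ! i))" for ms :: "nat list"
  have w_nonneg: "w ms \<ge> 0" for ms
    unfolding w_def by (intro prod_nonneg) auto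
  have weights: "(\<Sum>ms\<in>alt_tuples_ending (Suc ?r) n. 1 / w ms) = alt_psum (rev ks) n" for n
  proof -
    have "(\<Sum>ms\<in>alt_tuples_ending (Suc ?r) n. 1 / w ms) =
       (if odd (n + ?r) then \<Sum>m<n. \<Sum>ms\<in>alt_tuples_ending ?r m. 1 / w (ms @ [n]) else 0)"
      by (rule sum_alt_tuples_ending_Suc)
    \<comment> \<open>The product in \<open>w\<close> covers only the first \<open>?r\<close>
      positions, so the appended entry does not enter.\<close>
    also have "\<dots> = (if odd (n + ?r) then \<Sum>m<n. \<Sum>ms\<in>alt_tuples_ending ?r m. 1 / w ms else 0)"
      by (intro if_cong sum.cong refl arg_cong[of _ _ "\<lambda>x. 1 / x"])
        (auto simp: w_def nth_append alt_tuples_ending_def alt_tuples_length intro!: prod.cong)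
    finally show ?thesis
      by (simp add: w_def sum_alt_tuples_ending_eq_ath_coeff alt_psum_def)
  qed
  define S where "S = (SIGMA n:UNIV. alt_tuples_ending (Suc ?r) n)"
  have ne: "ms \<noteq> []" if "ms \<in> alt_tuples (Suc ?r)" for ms
    using that alt_tuples_length by fastforce
  have bij: "bij_betw snd S (alt_tuples (Suc ?r))"
    by (rule bij_betw_byWitness[of _ "\<lambda>ms. (last ms, ms)"])
      (auto simp: S_def alt_tuples_ending_def dest: ne split: if_splits)
  define g where "g = (\<lambda>(n, ms). f n / of_real (w ms))"
  have norm_g: "(\<Sum>ms\<in>alt_tuples_ending (Suc ?r) n. norm (g (n, ms))) = alt_psum (rev ks) n * norm (f n)" for n
    unfolding weights[symmetric] g_def
    by (simp add: sum_distrib_right norm_divide w_nonneg)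
  have sum_g: "(\<Sum>ms\<in>alt_tuples_ending (Suc ?r) n. g (n, ms)) = of_real (alt_psum (rev ks) n) * f n" for n
    unfolding weights[symmetric] g_def
    by (simp add: sum_distrib_right)
  have "(\<lambda>x. norm (g x)) summable_on S"
    unfolding S_def Infinite_Sum.abs_summable_on_Sigma_iff
    using summ
    by (simp add: finite_alt_tuples_ending norm_g alt_psum_nonneg summable_on_UNIV_nonneg_real_iff)
  then have "g summable_on S"
    by (rule Infinite_Sum.abs_summable_summable)
  then have "(\<Sum>\<^sub>\<infinity>n. \<Sum>\<^sub>\<infinity>ms\<in>alt_tuples_ending (Suc ?r) n. g (n, ms)) = infsum g S"
    unfolding S_def by (rule infsum_Sigma_banach)
  then have "infsum g S = (\<Sum>\<^sub>\<infinity>n. of_real (alt_psum (rev ks) n) * f n)"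
    by (simp add: finite_alt_tuples_ending sum_g)
  also have "\<dots> = (\<Sum>n. of_real (alt_psum (rev ks) n) * f n)"
  proof (rule infsumI, rule norm_summable_imp_has_sum)
    show "summable (\<lambda>n. norm (complex_of_real (alt_psum (rev ks) n) * f n))"
      using summ by (simp add: norm_mult alt_psum_nonneg)
    then show "(\<lambda>n. complex_of_real (alt_psum (rev ks) n) * f n) sums
                 (\<Sum>n. of_real (alt_psum (rev ks) n) * f n)"
      by (rule summable_sums[OF summable_norm_cancel])
  qed
  finally have eq: "infsum g S = (\<Sum>n. of_real (alt_psum (rev ks) n) * f n)" .
  have "infsum g S = (\<Sum>\<^sub>\<infinity>x\<in>S. f (last (snd x)) / of_real (w (snd x)))"
    by (intro infsum_cong) (auto simp: S_def g_def alt_tuples_ending_def dest: ne split: if_splits)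
  also have "\<dots> = (\<Sum>\<^sub>\<infinity>ms\<in>alt_tuples (Suc ?r). f (last ms) / of_real (w ms))"
    by (rule infsum_reindex_bij_betw[OF bij])
  finally show ?thesis by (simp add: w_def eq)
qed

lemma T0_eq_suminf:
  assumes "\<forall>k\<in>set ks. k \<ge> 1" "Re s > 1"
  shows "T0 ks s = (\<Sum>n. of_real (alt_psum (rev ks) n) * of_nat n powr (- s))"
proof -
  have n: "norm (of_nat n powr - s :: complex) = real n powr (- Re s)" for n
    using norm_powr_real_powr[of "of_nat n" "- s"] by simp
  have "T0 ks s = (\<Sum>\<^sub>\<infinity>ms\<in>alt_tuples (Suc (length ks)).
            of_nat (last ms) powr (- s) / of_real (\<Prod>i<length ks. real (ms ! i) ^ (ks ! i)))"
    unfolding T0_def Suc_eq_plus1 by (intro infsum_cong) (simp add: powr_minus divide_inverse mult_ac)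
  also have "\<dots> = (\<Sum>n. of_real (alt_psum (rev ks) n) * of_nat n powr (- s))"
    by (rule infsum_alt_tuples_Suc) (use assms in \<open>simp add: n summable_alt_psum_powr\<close>)
  finally show ?thesis .
qed

section \<open>The power series and its derivatives\<close>

text \<open>Only the real arguments \<open>tanh (t / 2)\<close> and \<open>exp (- t)\<close> occur,
  so the calculus is done over the reals; \<open>Ath_of_real\<close> makes the link to
  \<open>Ath\<close>.\<close>

definition ath_real :: "nat list \<Rightarrow> real \<Rightarrow> real" where
  "ath_real ks x = (\<Sum>n. ath_coeff ks n * x ^ n)"

lemma ath_real_Nil [simp]: "ath_real [] x = 1"
proof -
  have "(\<lambda>n. ath_coeff [] n * x ^ n) sums (\<Sum>n\<in>{0}. ath_coeff [] n * x ^ n)"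
    by (rule sums_finite) auto
  then show ?thesis by (simp add: ath_real_def sums_iff)
qed

lemma ath_real_at_0: "ath_real ks 0 = (if ks = [] then 1 else 0)"
  by (simp add: ath_real_def powser_zero ath_coeff_0)

lemma summable_ath_coeff_norm:
  assumes "\<forall>k\<in>set ks. k \<ge> 1" "\<bar>x\<bar> < 1"
  shows "summable (\<lambda>n. ath_coeff ks n * \<bar>x\<bar> ^ n)"
proof (rule summable_comparison_test')
  show "summable (\<lambda>n. \<bar>x\<bar> ^ n)"
    using assms by (intro summable_geometric) auto
  show "norm (ath_coeff ks n * \<bar>x\<bar> ^ n) \<le> \<bar>x\<bar> ^ n" if "n \<ge> 0" for n
    using ath_coeff_le_1[OF assms(1), of n] ath_coeff_nonneg[of ks n]
    by (simp add: abs_mult power_abs mult_left_le_one_le)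
qed

lemma summable_ath_coeff:
  assumes "\<forall>k\<in>set ks. k \<ge> 1" "\<bar>x\<bar> < 1"
  shows "summable (\<lambda>n. ath_coeff ks n * x ^ n)"
  by (rule summable_norm_cancel)
    (use summable_ath_coeff_norm[OF assms] in \<open>simp add: abs_mult power_abs ath_coeff_nonneg\<close>)

lemma ath_real_nonneg:
  assumes "\<forall>k\<in>set ks. k \<ge> 1" "0 \<le> x" "x < 1"
  shows "0 \<le> ath_real ks x"
  unfolding ath_real_def
  using assms by (intro suminf_nonneg summable_ath_coeff) (auto simp: ath_coeff_nonneg)

text \<open>The coefficients are at most 1 and the constant term vanishes, so a geometric series
  starting at \<open>x\<close> dominates. The leading factor \<open>x\<close> becomes exponential
  decay at \<open>x = exp (- t)\<close>.\<close>

lemma ath_real_le: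
  assumes "\<forall>k\<in>set ks. k \<ge> 1" "ks \<noteq> []" "0 \<le> x" "x < 1"
  shows "ath_real ks x \<le> x / (1 - x)"
proof -
  have geom: "(\<lambda>n. x * x ^ n) sums (x * (1 / (1 - x)))"
    using assms by (intro sums_mult geometric_sums) auto
  have "(\<lambda>n. ath_coeff ks (Suc n) * x ^ Suc n) sums ath_real ks x"
    using assms summable_ath_coeff[of ks x]
    by (subst sums_Suc_iff) (auto simp: ath_coeff_0 ath_real_def summable_sums)
  then have "ath_real ks x \<le> x * (1 / (1 - x))"
  proof (rule sums_le[OF _ _ geom, rotated])
    show "ath_coeff ks (Suc n) * x ^ Suc n \<le> x * x ^ n" for n
      using assms ath_coeff_le_1[OF assms(1), of "Suc n"]
      by (simp add: mult_left_le_one_le ath_coeff_nonneg)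
  qed
  then show ?thesis by simp
qed

text \<open>Multiplying the derivative by \<open>x\<close> undoes the index shift of termwise
  differentiation. The price is that at \<open>x = 0\<close> the series carries no information on
  \<open>D\<close>.\<close>

lemma ath_real_has_derivative:
  assumes "\<forall>k\<in>set ks. k \<ge> 1" "\<bar>x\<bar> < 1"
  obtains D where "(ath_real ks has_field_derivative D) (at x)"
    "(\<lambda>n. real n * ath_coeff ks n * x ^ n) sums (x * D)"
proof
  let ?D = "\<Sum>n. diffs (ath_coeff ks) n * x ^ n"
  have S: "norm y < 1 \<Longrightarrow> summable (\<lambda>n. ath_coeff ks n * y ^ n)" for y :: real
    using summable_ath_coeff[OF assms(1)] by simp
  show "(ath_real ks has_field_derivative ?D) (at x)"
    unfolding ath_real_def by (rule termdiffs_strong'[OF S]) (use assms in auto)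
  have "summable (\<lambda>n. diffs (ath_coeff ks) n * x ^ n)"
    using termdiff_converges[of x 1 "ath_coeff ks", OF _ S] assms by simp
  then have "(\<lambda>n. x * (diffs (ath_coeff ks) n * x ^ n)) sums (x * ?D)"
    by (intro sums_mult summable_sums)
  then have "(\<lambda>n. real (Suc n) * ath_coeff ks (Suc n) * x ^ Suc n) sums (x * ?D)"
    by (simp add: diffs_def mult_ac)
  then show "(\<lambda>n. real n * ath_coeff ks n * x ^ n) sums (x * ?D)"
    by (subst (asm) sums_Suc_iff) simp
qed

text \<open>The factor \<open>n\<close> from differentiation cancels one power of \<open>n\<close>
  in the denominator.\<close>

lemma ath_real_Suc_Cons_deriv:
  assumes "\<forall>k\<in>set ks. k \<ge> 1" "k \<ge> 1" "\<bar>x\<bar> < 1" "x \<noteq> 0"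
  shows "(ath_real (Suc k # ks) has_field_derivative ath_real (k # ks) x / x) (at x)"
proof -
  obtain D where D: "(ath_real (Suc k # ks) has_field_derivative D) (at x)"
    "(\<lambda>n. real n * ath_coeff (Suc k # ks) n * x ^ n) sums (x * D)"
    using assms ath_real_has_derivative[of "Suc k # ks" x] by auto
  have "real n * ath_coeff (Suc k # ks) n = ath_coeff (k # ks) n" for n
    by (cases "n = 0") (auto simp: ath_coeff_Cons)
  with D(2) have "x * D = ath_real (k # ks) x"
    by (simp add: ath_real_def sums_iff)
  then have "D = ath_real (k # ks) x / x"
    using assms by (simp add: field_simps)
  with D(1) show ?thesis by simp
qed

text \<open>Summing the recurrence \<open>alt_psum_Suc_Suc\<close> against powers of
  \<open>x\<close> gives a linear equation for the sum \<open>D\<close>, namely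
  \<open>D = x^2 * D + x * ath_real ks x\<close>.\<close>

lemma alt_psum_sums:
  assumes "\<forall>k\<in>set ks. k \<ge> 1" "\<bar>x\<bar> < 1"
  shows "(\<lambda>n. alt_psum ks n * x ^ n) sums (x / (1 - x\<^sup>2) * ath_real ks x)"
proof -
  \<comment> \<open>The prefixed exponent 1 supplies convergence: differentiation turns its
    coefficients into \<open>alt_psum\<close>.\<close>
  have "\<forall>k\<in>set (1 # ks). k \<ge> 1" using assms by auto
  then obtain D where D: "(\<lambda>n. real n * ath_coeff (1 # ks) n * x ^ n) sums D"
    using assms ath_real_has_derivative[of "1 # ks" x] by metis
  have "real n * ath_coeff (1 # ks) n = alt_psum ks n" for n
    by (cases "n = 0") (auto simp: ath_coeff_Cons)
  with D have S: "(\<lambda>n. alt_psum ks n * x ^ n) sums D"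
    by simp
  \<comment> \<open>The recurrence starts at index 2, so the terms at 0 and 1 are split off. For odd
    length both sides here are 0 by parity.\<close>
  have "alt_psum ks (Suc 0) = ath_coeff ks 0"
    using ath_coeff_parity[of 0 ks] by (auto simp: alt_psum_def)
  moreover have "(\<lambda>n. alt_psum ks (Suc n) * x ^ Suc n) sums D"
    using S sums_Suc_iff[of "\<lambda>n. alt_psum ks n * x ^ n" D] by simp
  ultimately have "(\<lambda>n. alt_psum ks (Suc (Suc n)) * x ^ Suc (Suc n)) sums (D - ath_coeff ks 0 * x)"
    using sums_Suc_iff[of "\<lambda>n. alt_psum ks (Suc n) * x ^ Suc n" "D - ath_coeff ks 0 * x"] by simp
  moreover have "(\<lambda>n. ath_coeff ks (Suc n) * x ^ Suc n) sums (ath_real ks x - ath_coeff ks 0)"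
    using summable_sums[OF summable_ath_coeff[OF assms]]
    by (subst sums_Suc_iff) (simp add: ath_real_def)
  then have "(\<lambda>n. x\<^sup>2 * (alt_psum ks n * x ^ n) + x * (ath_coeff ks (Suc n) * x ^ Suc n)) sums
               (x\<^sup>2 * D + x * (ath_real ks x - ath_coeff ks 0))"
    by (intro sums_add sums_mult S)
  then have "(\<lambda>n. alt_psum ks (Suc (Suc n)) * x ^ Suc (Suc n)) sums
               (x\<^sup>2 * D + x * (ath_real ks x - ath_coeff ks 0))"
    by (simp add: alt_psum_Suc_Suc power2_eq_square algebra_simps)
  ultimately have "D - ath_coeff ks 0 * x = x\<^sup>2 * D + x * (ath_real ks x - ath_coeff ks 0)"
    by (rule sums_unique2)
  then have "(1 - x\<^sup>2) * D = x * ath_real ks x"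
    by (simp add: algebra_simps)
  moreover have "1 - x\<^sup>2 \<noteq> 0"
    using assms abs_square_less_1[of x] by simp
  ultimately have "D = x / (1 - x\<^sup>2) * ath_real ks x"
    by (simp add: field_simps)
  with S show ?thesis by simp
qed

lemma ath_real_1_Cons_deriv:
  assumes "\<forall>k\<in>set ks. k \<ge> 1" "\<bar>x\<bar> < 1"
  shows "(ath_real (1 # ks) has_field_derivative ath_real ks x / (1 - x\<^sup>2)) (at x)"
proof (cases "x = 0")
  case False
  have "\<forall>k\<in>set (1 # ks). k \<ge> 1" using assms by auto
  then obtain D where D: "(ath_real (1 # ks) has_field_derivative D) (at x)"
    "(\<lambda>n. real n * ath_coeff (1 # ks) n * x ^ n) sums (x * D)"
    using assms ath_real_has_derivative[of "1 # ks" x] by metis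
  have "real n * ath_coeff (1 # ks) n = alt_psum ks n" for n
    by (cases "n = 0") (auto simp: ath_coeff_Cons)
  with D(2) have "(\<lambda>n. alt_psum ks n * x ^ n) sums (x * D)"
    by simp
  from sums_unique2[OF this alt_psum_sums[OF assms]]
  have "x * D = x * (ath_real ks x / (1 - x\<^sup>2))" by simp
  with False have "D = ath_real ks x / (1 - x\<^sup>2)"
    by (simp only: mult_cancel_left simp_thms)
  with D(1) show ?thesis by simp
next
  \<comment> \<open>Division by \<open>x\<close> is impossible here, so the derivative is read off
    as the constant term of the differentiated series. The point 0 matters because integration in
    \<open>t\<close> later starts from it.\<close>
  case True
  have S: "norm y < 1 \<Longrightarrow> summable (\<lambda>n. ath_coeff (1 # ks) n * y ^ n)" for y :: real
    using summable_ath_coeff[of "1 # ks"] assms by simp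
  have "(ath_real (1 # ks) has_field_derivative (\<Sum>n. diffs (ath_coeff (1 # ks)) n * 0 ^ n)) (at 0)"
    unfolding ath_real_def by (rule termdiffs_strong'[OF S]) auto
  moreover have "diffs (ath_coeff (1 # ks)) 0 = ath_coeff ks 0"
    using ath_coeff_parity[of 0 ks] by (auto simp: diffs_def ath_coeff_Cons alt_psum_def)
  ultimately show ?thesis
    using True by (simp add: powser_zero ath_real_at_0 ath_coeff_0)
qed

text \<open>The last exponent joins the power of \<open>x\<close> in a factor \<open>f\<close> of
  the last entry, which brings the sum over tuples into the form of
  \<open>infsum_alt_tuples_Suc\<close>.\<close>

lemma Ath_of_real:
  assumes "\<forall>k\<in>set ks. k \<ge> 1" "ks \<noteq> []" "\<bar>x\<bar> < 1"
  shows "Ath (map int ks) (of_real x) = of_real (ath_real (rev ks) x)"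
proof -
  obtain ls k where ks: "ks = ls @ [k]"
    using assms(2) by (cases ks rule: rev_cases) auto
  define f :: "nat \<Rightarrow> complex" where "f n = of_real x ^ n / of_nat n ^ k" for n
  have coeff: "of_real (alt_psum (rev ls) n) * f n = complex_of_real (ath_coeff (rev ks) n * x ^ n)" for n
    by (simp add: f_def ks ath_coeff_Cons)
  have ok: "\<forall>k\<in>set (rev ks). k \<ge> 1" using assms by simp
  have "Ath (map int ks) (of_real x) = (\<Sum>\<^sub>\<infinity>ms\<in>alt_tuples (Suc (length ls)).
            f (last ms) / of_real (\<Prod>i<length ls. real (ms ! i) ^ (ls ! i)))"
    unfolding Ath_def
  proof (simp only: length_map, rule infsum_cong_neutral)
    fix ms assume "ms \<in> alt_tuples (length ks) \<inter> alt_tuples (Suc (length ls))"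
    then have len: "length ms = Suc (length ls)" by (simp add: alt_tuples_length)
    then have last: "last ms = ms ! length ls"
      by (metis last_conv_nth diff_Suc_1 list.size(3) nat.distinct(1))
    show "of_real x ^ last ms / (\<Prod>i<length ks. of_nat (ms ! i) powi (map int ks ! i)) =
          f (last ms) / of_real (\<Prod>i<length ls. real (ms ! i) ^ (ls ! i))"
      by (simp add: ks f_def last nth_append power_int_def mult_ac)
  qed (auto simp: ks)
  also have "\<dots> = (\<Sum>n. of_real (alt_psum (rev ls) n) * f n)"
  proof (rule infsum_alt_tuples_Suc)
    have "alt_psum (rev ls) n * norm (f n) = ath_coeff (rev ks) n * \<bar>x\<bar> ^ n" for n
      by (simp add: f_def ks ath_coeff_Cons norm_divide norm_power)
    then show "summable (\<lambda>n. alt_psum (rev ls) n * norm (f n))"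
      using summable_ath_coeff_norm[OF ok assms(3)] by simp
  qed
  also have "\<dots> = of_real (ath_real (rev ks) x)"
    unfolding coeff ath_real_def
    by (rule suminf_of_real[symmetric, OF summable_ath_coeff[OF ok assms(3)]])
  finally show ?thesis .
qed

section \<open>The substitutions \<open>x = tanh (t / 2)\<close> and
  \<open>x = exp (- t)\<close>\<close>

lemma tanh_half_bounds:
  fixes t :: real
  shows "\<bar>tanh (t / 2)\<bar> < 1"
  using tanh_real_bounds[of "t/2"] by auto

text \<open>For \<open>x = tanh (t / 2)\<close> one has \<open>dx / x = dt / sinh t\<close> and, for
  head exponent 1, \<open>dx / (1 - x^2) = dt / 2\<close>.\<close>

lemma ath_real_tanh_Suc_deriv:
  assumes "\<forall>k\<in>set ks. k \<ge> 1" "k \<ge> 1" "t > 0"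
  shows "((\<lambda>t. ath_real (Suc k # ks) (tanh (t / 2))) has_field_derivative
           ath_real (k # ks) (tanh (t / 2)) / sinh t) (at t)"
proof -
  have T: "((\<lambda>t. tanh (t / 2)) has_field_derivative (1 - tanh (t / 2) ^ 2) / 2) (at t)"
    by (rule derivative_eq_intros refl | simp)+
  have "sinh t = 2 * sinh (t/2) * cosh (t/2)"
    using sinh_double[of "t/2"] by simp
  moreover have "1 - tanh (t / 2) ^ 2 = 1 / cosh (t / 2) ^ 2"
    using hyperbolic_pythagoras[of "t/2"] cosh_real_pos[of "t/2"]
    by (simp add: tanh_def divide_simps)
  moreover have "sinh (t/2) > 0" "cosh (t/2) > 0" using assms by auto
  ultimately have "(1 - tanh (t / 2) ^ 2) / 2 / tanh (t / 2) = 1 / sinh t"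
    by (simp add: tanh_def power2_eq_square)
  moreover have "tanh (t / 2) \<noteq> 0" using assms by simp
  ultimately have "ath_real (k # ks) (tanh (t / 2)) / tanh (t / 2) * ((1 - tanh (t / 2) ^ 2) / 2) =
      ath_real (k # ks) (tanh (t / 2)) / sinh t"
    by (metis divide_divide_eq_left' divide_inverse mult.assoc mult.commute mult_1 times_divide_eq_right)
  with \<open>tanh (t / 2) \<noteq> 0\<close> show ?thesis
    using DERIV_chain2[OF ath_real_Suc_Cons_deriv[OF assms(1,2) tanh_half_bounds[of t]] T]
    by simp
qed

lemma ath_real_tanh_1_deriv:
  assumes "\<forall>k\<in>set ks. k \<ge> 1"
  shows "((\<lambda>t. ath_real (1 # ks) (tanh (t / 2))) has_field_derivative
           ath_real ks (tanh (t / 2)) / 2) (at t)"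
proof -
  have T: "((\<lambda>t. tanh (t / 2)) has_field_derivative (1 - tanh (t / 2) ^ 2) / 2) (at t)"
    by (rule derivative_eq_intros refl | simp)+
  have "1 - tanh (t / 2) ^ 2 \<noteq> 0"
    using tanh_half_bounds[of t] abs_square_less_1[of "tanh (t/2)"] by simp
  then show ?thesis
    using DERIV_chain2[OF ath_real_1_Cons_deriv[OF assms tanh_half_bounds[of t]] T] by simp
qed

lemma ath_real_exp_Suc_deriv:
  assumes "\<forall>k\<in>set ks. k \<ge> 1" "k \<ge> 1" "t > 0"
  shows "((\<lambda>t. ath_real (Suc k # ks) (exp (- t))) has_field_derivative
           - ath_real (k # ks) (exp (- t))) (at t)"
proof -
  have E: "((\<lambda>t. exp (- t)) has_field_derivative - exp (- t)) (at t)"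
    by (rule derivative_eq_intros refl | simp)+
  have "\<bar>exp (- t)\<bar> < 1" using assms by simp
  from DERIV_chain2[OF ath_real_Suc_Cons_deriv[OF assms(1,2) this] E]
  show ?thesis by simp
qed

lemma sinh_eq_exp_ratio:
  fixes t :: real
  assumes "t > 0"
  shows "exp (- t) / (1 - (exp (- t))\<^sup>2) = 1 / (2 * sinh t)"
proof -
  have "exp (- t) * exp t = 1" by (simp add: exp_minus)
  moreover have "1 - (exp (- t))\<^sup>2 \<noteq> 0" "exp t - exp (- t) \<noteq> 0"
    using assms abs_square_less_1[of "exp (- t)"] by auto
  ultimately show ?thesis
    by (simp add: sinh_field_def field_simps power2_eq_square)
qed

text \<open>Compared with \<open>tanh\<close>, the two head cases have exchanged their weights:
  \<open>1 / sinh t\<close> now belongs to head exponent 1. This exchange lets both sides of the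
  expansion obey one recursion.\<close>

lemma ath_real_exp_1_deriv:
  assumes "\<forall>k\<in>set ks. k \<ge> 1" "t > 0"
  shows "((\<lambda>t. ath_real (1 # ks) (exp (- t))) has_field_derivative
           - ath_real ks (exp (- t)) / (2 * sinh t)) (at t)"
proof -
  have E: "((\<lambda>t. exp (- t)) has_field_derivative - exp (- t)) (at t)"
    by (rule derivative_eq_intros refl | simp)+
  have "\<bar>exp (- t)\<bar> < 1" using assms by simp
  from DERIV_chain2[OF ath_real_1_Cons_deriv[OF assms(1) this] E]
  have "((\<lambda>t. ath_real (1 # ks) (exp (- t))) has_field_derivative
           - (ath_real ks (exp (- t)) * (exp (- t) / (1 - (exp (- t))\<^sup>2)))) (at t)"
    by simp
  then show ?thesis
    unfolding sinh_eq_exp_ratio[OF assms(2)] by simp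
qed

text \<open>By induction both sides have the same derivative in \<open>t\<close>, and for positive
  \<open>r\<close> both vanish at \<open>t = 0\<close>.\<close>

lemma ath_real_ones_tanh:
  "ath_real (replicate r 1) (tanh (t / 2)) = (t / 2) ^ r / fact r"
proof (induction r arbitrary: t)
  case (Suc r)
  let ?g = "\<lambda>t. ath_real (1 # replicate r 1) (tanh (t / 2)) - (t / 2) ^ Suc r / fact (Suc r)"
  have "(?g has_field_derivative 0) (at t)" for t
  proof -
    have "((\<lambda>t. (t / 2) ^ Suc r / fact (Suc r)) has_field_derivative
            real (Suc r) * (t / 2) ^ r * (1 / 2) / fact (Suc r)) (at t)"
      by (rule derivative_eq_intros refl | simp)+
    also have "real (Suc r) * (t / 2) ^ r * (1 / 2) / fact (Suc r) = (t / 2) ^ r / fact r / 2"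
      by (simp add: divide_simps del: of_nat_Suc)
    finally show ?thesis
      using DERIV_diff[OF ath_real_tanh_1_deriv[of "replicate r 1" t]] Suc by fastforce
  qed
  then have "?g t = ?g 0"
    by (intro DERIV_isconst_all) auto
  then show ?case by (simp add: ath_real_at_0)
qed simp

section \<open>Limits at infinity\<close>

lemma ath_real_exp_tendsto_0:
  assumes "\<forall>k\<in>set ks. k \<ge> 1" "ks \<noteq> []"
  shows "((\<lambda>t. t ^ c * ath_real ks (exp (- t))) \<longlongrightarrow> 0) at_top"
proof (rule tendsto_sandwich)
  show "eventually (\<lambda>t. 0 \<le> t ^ c * ath_real ks (exp (- t))) at_top"
    using eventually_gt_at_top[of 0] by eventually_elim (use assms in \<open>auto intro!: mult_nonneg_nonneg ath_real_nonneg\<close>)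
  show "eventually (\<lambda>t. t ^ c * ath_real ks (exp (- t)) \<le> t ^ c * (exp (- t) / (1 - exp (- t)))) at_top"
    using eventually_gt_at_top[of 0]
    by eventually_elim (use assms in \<open>auto intro!: mult_left_mono ath_real_le simp del: times_divide_eq_right\<close>)
  show "((\<lambda>t. t ^ c * (exp (- t) / (1 - exp (- t)))) \<longlongrightarrow> (0::real)) at_top"
  proof -
    have e0: "((\<lambda>t::real. exp (- t)) \<longlongrightarrow> 0) at_top"
      by (rule filterlim_compose[OF exp_at_bot filterlim_uminus_at_bot_at_top])
    have "((\<lambda>t. (t ^ c / exp t) * (1 / (1 - exp (- t)))) \<longlongrightarrow> 0 * (1 / (1 - (0::real)))) at_top"
      by (intro tendsto_intros tendsto_power_div_exp_0 e0) auto
    then show ?thesis by (simp add: exp_minus field_simps)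
  qed
qed auto

lemma alt_psum_powr_eq_ath_coeff:
  assumes "k \<ge> 1"
  shows "alt_psum ks n * real n powr (- real k) = ath_coeff (k # ks) n"
  using assms by (cases "n = 0") (auto simp: ath_coeff_Cons powr_minus powr_realpow field_simps)

lemma summable_ath_coeff_Cons:
  assumes "\<forall>k\<in>set ks. k \<ge> 1" "k \<ge> 2"
  shows "summable (ath_coeff (k # ks))"
  using summable_alt_psum_powr[of ks "real k"] assms
  by (simp add: alt_psum_powr_eq_ath_coeff)

text \<open>A head exponent of at least 2 makes the coefficients summable, so the M-test gives
  continuity up to the endpoint 1, which \<open>tanh (t / 2)\<close> approaches from below.\<close>

lemma ath_real_tendsto_at_1:
  assumes "\<forall>k\<in>set ks. k \<ge> 1" "k \<ge> 2"
  shows "((\<lambda>t. ath_real (k # ks) (tanh (t / 2))) \<longlongrightarrow> (\<Sum>n. ath_coeff (k # ks) n)) at_top"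
proof -
  have "uniform_limit {0..1} (\<lambda>n x. \<Sum>i<n. ath_coeff (k # ks) i * x ^ i) (ath_real (k # ks)) sequentially"
    unfolding ath_real_def
  proof (rule Weierstrass_m_test)
    show "norm (ath_coeff (k # ks) n * x ^ n) \<le> ath_coeff (k # ks) n" if "x \<in> {0..1}" for n and x :: real
      using that ath_coeff_nonneg[of "k # ks" n] by (simp add: abs_mult power_le_one mult_left_le)
  qed (rule summable_ath_coeff_Cons[OF assms])
  then have "continuous_on {0..1} (ath_real (k # ks))"
    by (rule uniform_limit_theorem[rotated]) (auto intro!: continuous_intros always_eventually)
  then have lim: "(ath_real (k # ks) \<longlongrightarrow> ath_real (k # ks) 1) (at 1 within {0..1})"
    by (simp add: continuous_on_def)
  have "filterlim (\<lambda>t::real. tanh (t / 2)) (at 1 within {0..1}) at_top"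
    unfolding filterlim_at
  proof
    show "eventually (\<lambda>t::real. tanh (t / 2) \<in> {0..1} \<and> tanh (t / 2) \<noteq> 1) at_top"
      using eventually_gt_at_top[of 0]
    proof eventually_elim
      case (elim t)
      then show ?case using tanh_half_bounds[of t] by auto
    qed
    show "((\<lambda>t::real. tanh (t / 2)) \<longlongrightarrow> 1) at_top"
      by (rule filterlim_compose[OF tanh_real_at_top])
        (rule filterlim_at_top_mult_tendsto_pos[of "\<lambda>_. 1/2" "1/2" _ "\<lambda>t. t", simplified]; simp add: filterlim_ident)
  qed
  from filterlim_compose[OF lim this] show ?thesis
    by (simp add: ath_real_def)
qed

section \<open>Expansion at infinity\<close>

text \<open>These are weak compositions: zero parts are allowed.\<close>

definition compositions :: "nat \<Rightarrow> nat \<Rightarrow> nat list set" where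
  "compositions k n = {a. length a = k \<and> sum_list a = n}"

lemma compositions_0: "compositions 0 n = (if n = 0 then {[]} else {})"
  by (auto simp: compositions_def)

lemma compositions_Suc:
  "compositions (Suc k) n = (\<Union>c\<le>n. (\<lambda>a. a @ [c]) ` compositions k (n - c))"
proof (intro set_eqI)
  fix xs :: "nat list"
  show "xs \<in> compositions (Suc k) n \<longleftrightarrow> xs \<in> (\<Union>c\<le>n. (\<lambda>a. a @ [c]) ` compositions k (n - c))"
    by (cases xs rule: rev_cases) (auto simp: compositions_def image_iff)
qed

lemma finite_compositions: "finite (compositions k n)"
  by (induction k arbitrary: n) (simp_all add: compositions_0 compositions_Suc)

lemma sum_compositions_Suc:
  "sum f (compositions (Suc k) n) = (\<Sum>c\<le>n. \<Sum>a\<in>compositions k (n - c). f (a @ [c]))"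
proof -
  have "sum f (\<Union>c\<le>n. (\<lambda>a. a @ [c]) ` compositions k (n - c)) =
          (\<Sum>c\<le>n. sum f ((\<lambda>a. a @ [c]) ` compositions k (n - c)))"
    by (rule sum.UNION_disjoint) (auto simp: finite_compositions)
  also have "\<dots> = (\<Sum>c\<le>n. \<Sum>a\<in>compositions k (n - c). f (a @ [c]))"
    by (rule sum.cong[OF refl], subst sum.reindex) (auto simp: inj_on_def)
  finally show ?thesis by (simp add: compositions_Suc)
qed

text \<open>The total of all depth-\<open>k\<close> series of weight \<open>n + k\<close>, a part
  \<open>a\<close> standing for the exponent \<open>a + 1\<close>.\<close>

definition ath_comp :: "nat \<Rightarrow> nat \<Rightarrow> real \<Rightarrow> real" where
  "ath_comp k n t = (\<Sum>a\<in>compositions k n. ath_real (rev (map Suc a)) (exp (- t)))"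

lemma ath_comp_0: "ath_comp 0 n t = (if n = 0 then 1 else 0)"
  by (simp add: ath_comp_def compositions_0)

lemma ath_comp_Suc:
  "ath_comp (Suc k) n t =
     (\<Sum>c\<le>n. \<Sum>a\<in>compositions k (n - c). ath_real (Suc c # rev (map Suc a)) (exp (- t)))"
  by (simp add: ath_comp_def sum_compositions_Suc)

text \<open>
  Lowering the head exponent \<open>Suc c\<close> leads to a composition of \<open>n - 1\<close>, except for \<open>c = 0\<close>, where the
  head is lost and the depth drops.
\<close>

lemma ath_comp_deriv:
  assumes "t > 0"
  shows "(ath_comp (Suc k) n has_field_derivative
           (- ath_comp k n t / (2 * sinh t) - (if n = 0 then 0 else ath_comp (Suc k) (n - 1) t))) (at t)"
proof -
  let ?l = "\<lambda>a. rev (map Suc a)"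
  have ok: "\<forall>k\<in>set (?l a). k \<ge> 1" for a by auto
  have d0: "((\<lambda>t. \<Sum>a\<in>compositions k n. ath_real (Suc 0 # ?l a) (exp (- t))) has_field_derivative
          (\<Sum>a\<in>compositions k n. - ath_real (?l a) (exp (- t)) / (2 * sinh t))) (at t)"
    by (rule DERIV_sum) (use ath_real_exp_1_deriv[OF ok assms] in simp)
  have d: "((\<lambda>t. \<Sum>c<n. \<Sum>a\<in>compositions k (n - Suc c). ath_real (Suc (Suc c) # ?l a) (exp (- t)))
        has_field_derivative
          (\<Sum>c<n. \<Sum>a\<in>compositions k (n - Suc c). - ath_real (Suc c # ?l a) (exp (- t)))) (at t)"
    by (intro DERIV_sum ath_real_exp_Suc_deriv[OF ok _ assms]) simp
  have "ath_comp (Suc k) n = (\<lambda>t. (\<Sum>a\<in>compositions k n. ath_real (Suc 0 # ?l a) (exp (- t))) +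
      (\<Sum>c<n. \<Sum>a\<in>compositions k (n - Suc c). ath_real (Suc (Suc c) # ?l a) (exp (- t))))"
    by (simp add: ath_comp_Suc sum.atMost_shift fun_eq_iff)
  moreover have "(\<Sum>a\<in>compositions k n. - ath_real (?l a) (exp (- t)) / (2 * sinh t)) =
      - ath_comp k n t / (2 * sinh t)"
    by (simp add: ath_comp_def sum_divide_distrib sum_negf)
  moreover have "(\<Sum>c<n. \<Sum>a\<in>compositions k (n - Suc c). - ath_real (Suc c # ?l a) (exp (- t))) =
      - (if n = 0 then 0 else ath_comp (Suc k) (n - 1) t)"
    by (cases n) (simp_all add: ath_comp_Suc sum_negf lessThan_Suc_atMost)
  ultimately show ?thesis
    using DERIV_add[OF d0 d] by simp
qed

lemma ath_comp_tendsto_0: "((\<lambda>t. t ^ c * ath_comp (Suc k) n t) \<longlongrightarrow> 0) at_top"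
proof -
  have "((\<lambda>t. \<Sum>a\<in>compositions (Suc k) n. t ^ c * ath_real (rev (map Suc a)) (exp (- t)))
          \<longlongrightarrow> (\<Sum>a\<in>compositions (Suc k) n. 0)) at_top"
    by (intro tendsto_sum ath_real_exp_tendsto_0) (auto simp: compositions_def)
  then show ?thesis
    by (simp add: ath_comp_def sum_distrib_left)
qed

text \<open>Ranges over compositions of \<open>r\<close> into \<open>k + 1\<close> parts whose last
  part \<open>c\<close> becomes a power of \<open>t\<close> and not an exponent. Under the Mellin
  transform \<open>t ^ c\<close> shifts \<open>s\<close> to \<open>s + c\<close>.\<close>

definition comp_remainder :: "nat \<Rightarrow> nat \<Rightarrow> real \<Rightarrow> real" where
  "comp_remainder k r t = (\<Sum>c\<le>r. t ^ c / fact c * ath_comp k (r - c) t)"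

lemma comp_remainder_0: "comp_remainder 0 r t = t ^ r / fact r"
proof -
  have "comp_remainder 0 r t = (\<Sum>c\<le>r. if c = r then t ^ c / fact c else 0)"
    unfolding comp_remainder_def by (intro sum.cong) (auto simp: ath_comp_0)
  then show ?thesis by simp
qed

text \<open>Lowering the power of \<open>t\<close> and lowering a head exponent in
  \<open>ath_comp\<close> yield the same sum with opposite signs. Only the terms in which the depth
  drops survive.\<close>

lemma comp_remainder_deriv:
  assumes "t > 0"
  shows "(comp_remainder (Suc k) r has_field_derivative
           - comp_remainder k r t / (2 * sinh t)) (at t)"
proof -
  let ?q = "\<lambda>m. ath_comp (Suc k) m t"
  let ?d = "\<lambda>m. - ath_comp k m t / (2 * sinh t) - (if m = 0 then 0 else ?q (m - 1))"
  have pow: "((\<lambda>t. t ^ c / fact c) has_field_derivative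
      (if c = 0 then 0 else t ^ (c - 1) / fact (c - 1))) (at t)" for c
  proof (cases c)
    case (Suc b)
    have "((\<lambda>t. t ^ Suc b / fact (Suc b)) has_field_derivative
            real (Suc b) * t ^ b / fact (Suc b)) (at t)"
      by (rule derivative_eq_intros refl | simp)+
    also have "real (Suc b) * t ^ b / fact (Suc b) = t ^ b / fact b"
      by (simp add: divide_simps del: of_nat_Suc)
    finally show ?thesis using Suc by simp
  qed simp
  have "(comp_remainder (Suc k) r has_field_derivative
      (\<Sum>c\<le>r. (if c = 0 then 0 else t ^ (c - 1) / fact (c - 1)) * ?q (r - c) +
              ?d (r - c) * (t ^ c / fact c))) (at t)"
    unfolding comp_remainder_def[abs_def]
    by (intro DERIV_sum DERIV_mult pow ath_comp_deriv[OF assms])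
  also have "(\<Sum>c\<le>r. (if c = 0 then 0 else t ^ (c - 1) / fact (c - 1)) * ?q (r - c) +
              ?d (r - c) * (t ^ c / fact c)) =
      (\<Sum>c\<le>r. (if c = 0 then 0 else t ^ (c - 1) / fact (c - 1)) * ?q (r - c)) -
      (\<Sum>c\<le>r. t ^ c / fact c * (if r - c = 0 then 0 else ?q (r - c - 1))) -
      (\<Sum>c\<le>r. t ^ c / fact c * ath_comp k (r - c) t / (2 * sinh t))"
    unfolding sum_subtractf[symmetric] by (intro sum.cong refl) (simp add: algebra_simps)
  also have "(\<Sum>c\<le>r. (if c = 0 then 0 else t ^ (c - 1) / fact (c - 1)) * ?q (r - c)) =
      (\<Sum>c<r. t ^ c / fact c * ?q (r - Suc c))"
    by (simp add: sum.atMost_shift)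
  also have "(\<Sum>c\<le>r. t ^ c / fact c * (if r - c = 0 then 0 else ?q (r - c - 1))) =
      (\<Sum>c<r. t ^ c / fact c * ?q (r - Suc c))"
    by (simp add: lessThan_Suc_atMost[symmetric])
  finally show ?thesis
    by (simp add: comp_remainder_def[abs_def] sum_divide_distrib)
qed

lemma comp_remainder_tendsto_0: "(comp_remainder (Suc k) r \<longlongrightarrow> 0) at_top"
proof -
  have "((\<lambda>t. \<Sum>c\<le>r. (1 / fact c) * (t ^ c * ath_comp (Suc k) (r - c) t)) \<longlongrightarrow>
          (\<Sum>c\<le>r. (1 / fact c) * 0)) at_top"
    by (intro tendsto_intros ath_comp_tendsto_0)
  then show ?thesis
    by (simp add: comp_remainder_def[abs_def])
qed

text \<open>Each induction step integrates once against \<open>1 / sinh t\<close>; the factor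
  \<open>- 2\<close> compensates the \<open>- 1 / (2 * sinh t)\<close> in the derivatives on the
  right. The power \<open>2 ^ Suc q\<close> comes from \<open>(t / 2) ^ Suc q\<close> in the base
  case.\<close>

lemma ath_real_tanh_expansion:
  assumes "t > 0"
  shows "ath_real (Suc k # replicate q 1) (tanh (t / 2)) =
     (\<Sum>j<k. (- 2) ^ j * (\<Sum>n. ath_coeff ((Suc k - j) # replicate q 1) n) *
               ath_real (replicate j 1) (exp (- t))) +
     (- 2) ^ k / 2 ^ Suc q * comp_remainder k (Suc q) t"
  using assms
proof (induction k arbitrary: t)
  case 0
  then show ?case
    using ath_real_ones_tanh[of "Suc q" t]
    by (simp add: comp_remainder_0 power_divide)
next
  case (Suc k)
  define \<tau> where "\<tau> k = (\<Sum>n. ath_coeff (k # replicate q 1) n)" for k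
  define L where "L t = ath_real (Suc (Suc k) # replicate q 1) (tanh (t / 2))" for t
  \<comment> \<open>\<open>M\<close> is the claimed sum without its \<open>j = 0\<close> term,
    reindexed by one. The missing term is the constant \<open>\<tau> (Suc (Suc k))\<close>, still to
    be found as the constant of integration.\<close>
  define M where "M t = (\<Sum>j<k. (- 2) ^ Suc j * \<tau> (Suc k - j) *
               ath_real (1 # replicate j 1) (exp (- t)))" for t
  define R where "R t = (- 2) ^ Suc k / 2 ^ Suc q * comp_remainder (Suc k) (Suc q) t" for t
  have ones: "\<forall>k\<in>set (replicate j 1). (k::nat) \<ge> 1" for j by simp
  have L: "(L has_field_derivative ath_real (Suc k # replicate q 1) (tanh (t / 2)) / sinh t) (at t)"
    if "t > 0" for t
    unfolding L_def[abs_def] using that by (intro ath_real_tanh_Suc_deriv ones) auto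
  have M: "(M has_field_derivative
      (\<Sum>j<k. (- 2) ^ Suc j * \<tau> (Suc k - j) *
          (- ath_real (replicate j 1) (exp (- t)) / (2 * sinh t)))) (at t)" if "t > 0" for t
    unfolding M_def[abs_def]
    by (intro DERIV_sum DERIV_cmult ath_real_exp_1_deriv ones that)
  have R: "(R has_field_derivative
      (- 2) ^ Suc k / 2 ^ Suc q * (- comp_remainder k (Suc q) t / (2 * sinh t))) (at t)" if "t > 0" for t
    unfolding R_def[abs_def] by (intro DERIV_cmult comp_remainder_deriv that)
  have "((\<lambda>t. L t - M t - R t) has_field_derivative 0) (at t)" if "t > 0" for t
  proof -
    have "(\<Sum>j<k. (- 2) ^ Suc j * \<tau> (Suc k - j) *
          (- ath_real (replicate j 1) (exp (- t)) / (2 * sinh t))) =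
        (\<Sum>j<k. (- 2) ^ j * \<tau> (Suc k - j) * ath_real (replicate j 1) (exp (- t))) / sinh t"
      unfolding sum_divide_distrib by (intro sum.cong refl) simp
    moreover have "(- 2) ^ Suc k / 2 ^ Suc q * (- comp_remainder k (Suc q) t / (2 * sinh t)) =
        (- 2) ^ k / 2 ^ Suc q * comp_remainder k (Suc q) t / sinh t"
      by simp
    ultimately show ?thesis
      using DERIV_diff[OF DERIV_diff[OF L[OF that] M[OF that]] R[OF that]] Suc.IH[OF that]
      by (simp add: \<tau>_def add_divide_distrib)
  qed
  then have "\<exists>c. \<forall>t\<in>{0<..}. L t - M t - R t = c"
    by (intro has_field_derivative_zero_constant) (auto intro: has_field_derivative_at_within)
  then obtain c where c: "L t - M t - R t = c" if "t > 0" for t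
    by auto
  \<comment> \<open>The head exponent of \<open>L\<close> is at least 2, so its limit is finite;
    \<open>M\<close> and \<open>R\<close> decay, and the limit of \<open>L\<close> alone fixes the
    constant.\<close>
  have "((\<lambda>t. L t - M t - R t) \<longlongrightarrow>
      \<tau> (Suc (Suc k)) - (\<Sum>j<k. (- 2) ^ Suc j * \<tau> (Suc k - j) * 0) -
      (- 2) ^ Suc k / 2 ^ Suc q * 0) at_top"
    unfolding L_def M_def R_def \<tau>_def
    using ath_real_exp_tendsto_0[of "1 # replicate _ 1" 0] ones
    by (intro tendsto_intros ath_real_tendsto_at_1 comp_remainder_tendsto_0) auto
  moreover have "((\<lambda>t. L t - M t - R t) \<longlongrightarrow> c) at_top"
    by (rule tendsto_eventually) (use eventually_gt_at_top[of 0] in eventually_elim, rule c)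
  ultimately have "c = \<tau> (Suc (Suc k))"
    using tendsto_unique[OF trivial_limit_at_top_linorder] by fastforce
  then have "L t = \<tau> (Suc (Suc k)) + M t + R t"
    using c[OF Suc.prems] by simp
  then show ?case
    unfolding L_def M_def R_def \<tau>_def
    by (subst sum.lessThan_Suc_shift) simp
qed

section \<open>Mellin transforms\<close>

text \<open>The Gamma integral is available over the completed measure; continuity makes the
  integrand Borel measurable, which carries it over to \<open>lborel\<close>.\<close>

lemma has_bochner_integral_Gamma:
  assumes "Re z > 0"
  shows "has_bochner_integral lborel
    (\<lambda>t. indicator {0<..} t *\<^sub>R (of_real t powr (z - 1) / of_real (exp t))) (Gamma z)"
proof -
  let ?f = "\<lambda>t::real. of_real t powr (z - 1) / of_real (exp t) :: complex"
  have "continuous_on {0<..} ?f"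
    by (intro continuous_intros) (auto simp: complex_nonpos_Reals_iff)
  then have meas: "(\<lambda>t. indicator {0<..} t *\<^sub>R ?f t) \<in> borel_measurable lborel"
    using borel_measurable_continuous_on_indicator[of "{0<..}" ?f] by simp
  have "integrable lebesgue (\<lambda>t. indicator {0<..} t *\<^sub>R ?f t)"
    using absolutely_integrable_Gamma_integral'[OF assms] by (simp add: set_integrable_def)
  then have int: "set_integrable lborel {0<..} ?f"
    unfolding set_integrable_def using integrable_completion[OF meas] by simp
  have "(LBINT t:{0<..}. ?f t) = Gamma z"
    using set_borel_integral_eq_integral(2)[OF int] Gamma_integral_complex'[OF assms]
    by (simp add: integral_unique)
  then show ?thesis
    using int by (simp add: has_bochner_integral_iff set_integrable_def set_lebesgue_integral_def)
qed

lemma has_bochner_integral_Gamma_scaled: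
  assumes "Re z > 0" "c > 0"
  shows "has_bochner_integral lborel
    (\<lambda>t. indicator {0<..} t *\<^sub>R (of_real t powr (z - 1) * of_real (exp (- (c * t)))))
    (Gamma z * of_real c powr (- z))"
proof -
  let ?f = "\<lambda>t::real. indicator {0<..} t *\<^sub>R (of_real t powr (z - 1) / of_real (exp t)) :: complex"
  have "has_bochner_integral lborel (\<lambda>t. ?f (0 + c * t)) (Gamma z /\<^sub>R \<bar>c\<bar>)"
    using has_bochner_integral_Gamma[OF assms(1)] lborel_has_bochner_integral_real_affine_iff[of c ?f _ 0] assms
    by simp
  \<comment> \<open>The factor \<open>c powr (1 - z)\<close> cancels the power of \<open>c\<close>
    in \<open>(c * t) powr (z - 1)\<close>; with the Jacobian \<open>1 / c\<close> it leaves
    \<open>c powr (- z)\<close>.\<close>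
  then have "has_bochner_integral lborel (\<lambda>t. of_real c powr (1 - z) * ?f (0 + c * t))
      (of_real c powr (1 - z) * (Gamma z /\<^sub>R \<bar>c\<bar>))"
    by (rule has_bochner_integral_mult_right)
  moreover have "of_real c powr (1 - z) * (Gamma z /\<^sub>R \<bar>c\<bar>) = Gamma z * of_real c powr (- z)"
    using assms by (simp add: powr_diff powr_minus scaleR_conv_of_real field_simps)
  moreover have "of_real c powr (1 - z) * ?f (0 + c * t) =
      indicator {0<..} t *\<^sub>R (of_real t powr (z - 1) * of_real (exp (- (c * t))))" for t
  proof (cases "t > 0")
    case True
    have "complex_of_real c powr (1 - z) * (of_real c powr (z - 1)) = 1"
      using assms by (simp add: powr_add[symmetric])
    then show ?thesis
      using True assms by (simp add: powr_times_real exp_minus field_simps)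
  qed (use assms in \<open>simp add: zero_less_mult_iff\<close>)
  ultimately show ?thesis by simp
qed

text \<open>This is scaling by \<open>c = n\<close>. For \<open>n = 0\<close> the exponential does
  not decay, but \<open>alt_psum ks 0 = 0\<close> makes both sides vanish.\<close>

lemma has_bochner_integral_alt_psum_term:
  assumes "Re w > 0"
  shows "has_bochner_integral lborel
    (\<lambda>t. indicator {0<..} t *\<^sub>R (of_real t powr (w - 1) * of_real (alt_psum ks n * exp (- t) ^ n)))
    (Gamma w * (of_real (alt_psum ks n) * of_nat n powr (- w)))"
proof (cases "n = 0")
  case False
  have "has_bochner_integral lborel
    (\<lambda>t. of_real (alt_psum ks n) *
       (indicator {0<..} t *\<^sub>R (of_real t powr (w - 1) * of_real (exp (- (real n * t))))))
    (of_real (alt_psum ks n) * (Gamma w * of_real (real n) powr (- w)))"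
    using False assms by (intro has_bochner_integral_mult_right has_bochner_integral_Gamma_scaled) auto
  moreover have "exp (- (real n * t)) = exp (- t) ^ n" for t
    by (simp add: exp_of_nat_mult[symmetric])
  ultimately show ?thesis by (simp add: mult_ac)
qed (simp add: has_bochner_integral_zero)

text \<open>Dividing by \<open>sinh t\<close> turns the coefficients into twice
  \<open>alt_psum\<close>, so the depth rises by one, and each term contributes a Gamma factor times
  \<open>n powr (- w)\<close>. The interchange rests on absolute convergence for
  \<open>Re w > 1\<close>.\<close>

lemma has_bochner_integral_ath_real:
  assumes ks: "\<forall>k\<in>set ks. k \<ge> 1" and w: "Re w > 1"
  shows "has_bochner_integral lborel
    (\<lambda>t. indicator {0<..} t *\<^sub>R
       (of_real t powr (w - 1) * of_real (ath_real (rev ks) (exp (- t)) / sinh t)))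
    (2 * Gamma w * T0 ks w)"
proof -
  define f where "f z n t = indicator {0<..} t *\<^sub>R
     (of_real t powr (z - 1) * complex_of_real (alt_psum (rev ks) n * exp (- t) ^ n))" for z n t
  have ks': "\<forall>k\<in>set (rev ks). k \<ge> 1" using ks by simp
  have f: "has_bochner_integral lborel (f z n)
      (Gamma z * (of_real (alt_psum (rev ks) n) * of_nat n powr (- z)))" if "Re z > 1" for z n
    unfolding f_def[abs_def] by (rule has_bochner_integral_alt_psum_term) (use that in simp)
  \<comment> \<open>The norm of a term is the same term at the real exponent \<open>Re w\<close>, so
    the integrals of the norms come from the formula \<open>f\<close> itself.\<close>
  have norm_f: "norm (f w n t) = Re (f (of_real (Re w)) n t)" for n t
  proof (cases "t > 0")
    case True
    have "complex_of_real t powr (of_real (Re w) - 1) = of_real (t powr (Re w - 1))"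
      using True powr_of_real[of t "Re w - 1"] by simp
    moreover have "norm (complex_of_real t powr (w - 1)) = t powr (Re w - 1)"
      using True norm_powr_real_powr[of "of_real t" "w - 1"] by simp
    ultimately show ?thesis
      using True by (simp add: f_def norm_mult norm_power alt_psum_nonneg)
  qed (simp add: f_def)
  have "has_bochner_integral lborel (\<lambda>t. norm (f w n t))
      (Re (Gamma (complex_of_real (Re w)) *
         (of_real (alt_psum (rev ks) n) * of_nat n powr (- complex_of_real (Re w)))))" for n
    unfolding norm_f
    by (rule has_bochner_integral_bounded_linear[OF bounded_linear_Re f]) (use w in simp)
  moreover have "of_nat n powr (- complex_of_real x) = of_real (real n powr (- x))" for n x
    using powr_of_real[of "real n" "- x"] by simp
  ultimately have norm_int: "has_bochner_integral lborel (\<lambda>t. norm (f w n t))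
      (Gamma (Re w) * (alt_psum (rev ks) n * real n powr (- Re w)))" for n
    by (simp add: Gamma_complex_of_real)
  have sums: "(\<lambda>n. alt_psum (rev ks) n * exp (- t) ^ n) sums
      (ath_real (rev ks) (exp (- t)) / sinh t / 2)" if "t > 0" for t
    using alt_psum_sums[OF ks', of "exp (- t)"] that sinh_eq_exp_ratio[OF that]
    by (simp add: mult.commute)
  have f_summable: "summable (\<lambda>n. norm (f w n t))" for t
  proof (cases "t > 0")
    case True
    have "summable (\<lambda>n. norm (of_real t powr (w - 1) :: complex) * (alt_psum (rev ks) n * exp (- t) ^ n))"
      using sums[OF True] by (intro summable_mult) (simp add: sums_iff)
    then show ?thesis
      using True by (simp add: f_def norm_mult norm_power alt_psum_nonneg)
  qed (simp add: f_def)
  have int_summable: "summable (\<lambda>n. \<integral>t. norm (f w n t) \<partial>lborel)"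
    using norm_int summable_mult[OF summable_alt_psum_powr[OF ks' w]]
    by (simp add: has_bochner_integral_iff)
  have f_int: "integrable lborel (f w n)" for n
    using f[OF w] by (simp add: has_bochner_integral_iff)
  note interchange = f_int AE_I2[OF f_summable] int_summable
  have suminf_f: "(\<Sum>n. f w n t) = indicator {0<..} t *\<^sub>R
       (of_real t powr (w - 1) * of_real (ath_real (rev ks) (exp (- t)) / sinh t / 2))" for t
  proof (cases "t > 0")
    case True
    have "(\<lambda>n. of_real t powr (w - 1) * complex_of_real (alt_psum (rev ks) n * exp (- t) ^ n)) sums
        (of_real t powr (w - 1) * of_real (ath_real (rev ks) (exp (- t)) / sinh t / 2))"
      by (intro sums_mult sums_of_real sums True)
    then show ?thesis
      using True by (simp add: f_def sums_iff)
  qed (simp add: f_def)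
  have "(\<Sum>n. integral\<^sup>L lborel (f w n)) =
      (\<Sum>n. Gamma w * (of_real (alt_psum (rev ks) n) * of_nat n powr (- w)))"
    using f[OF w] by (simp add: has_bochner_integral_iff)
  also have "\<dots> = Gamma w * T0 ks w"
    unfolding T0_eq_suminf[OF ks w]
  proof (rule suminf_mult)
    have n: "norm (of_nat n powr - w :: complex) = real n powr (- Re w)" for n
      using norm_powr_real_powr[of "of_nat n" "- w"] by simp
    show "summable (\<lambda>n. complex_of_real (alt_psum (rev ks) n) * of_nat n powr (- w))"
      by (rule summable_norm_cancel)
        (use summable_alt_psum_powr[OF ks' w] in \<open>simp add: norm_mult n alt_psum_nonneg\<close>)
  qed
  finally have "has_bochner_integral lborel (\<lambda>t. \<Sum>n. f w n t) (Gamma w * T0 ks w)"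
    using integrable_suminf[OF interchange] integral_suminf[OF interchange]
    by (simp add: has_bochner_integral_iff)
  then have "has_bochner_integral lborel (\<lambda>t. 2 * (\<Sum>n. f w n t)) (2 * (Gamma w * T0 ks w))"
    by (rule has_bochner_integral_mult_right)
  moreover have "2 * (\<Sum>n. f w n t) = indicator {0<..} t *\<^sub>R
       (of_real t powr (w - 1) * of_real (ath_real (rev ks) (exp (- t)) / sinh t))" for t
    unfolding suminf_f by simp
  ultimately show ?thesis by (simp only: mult.assoc)
qed

section \<open>Assembling the identity\<close>

text \<open>Identifies the constants of integration in the expansion as values of
  \<open>T0\<close>.\<close>

lemma T0_of_nat:
  assumes "\<forall>k\<in>set ks. k \<ge> 1" "k \<ge> 2"
  shows "T0 ks (of_nat k) = of_real (\<Sum>n. ath_coeff (k # rev ks) n)"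
proof -
  have "of_nat n powr (- of_nat k) = complex_of_real (real n powr (- real k))" for n
    using powr_of_real[of "real n" "- real k"] by simp
  then have "T0 ks (of_nat k) = (\<Sum>n. complex_of_real (alt_psum (rev ks) n * real n powr (- real k)))"
    using assms by (simp add: T0_eq_suminf)
  also have "\<dots> = (\<Sum>n. complex_of_real (ath_coeff (k # rev ks) n))"
    using assms by (simp add: alt_psum_powr_eq_ath_coeff)
  also have "\<dots> = of_real (\<Sum>n. ath_coeff (k # rev ks) n)"
    using assms by (intro suminf_of_real[symmetric] summable_ath_coeff_Cons) auto
  finally show ?thesis .
qed

text \<open>The pointwise expansion is transformed summand by summand; \<open>Re s > 1\<close> makes
  each summand integrable on its own, despite the pole of \<open>1 / sinh t\<close> at 0.\<close>

lemma psi_eq: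
  assumes "Re s > 1"
  shows "psi (replicate q 1 @ [Suc k]) s = 2 ^ Suc q / Gamma s *
    ((\<Sum>j<k. of_real ((- 2) ^ j * (\<Sum>n. ath_coeff ((Suc k - j) # replicate q 1) n)) *
        (2 * Gamma s * T0 (replicate j 1) s)) +
     (- 2) ^ k / 2 ^ Suc q * (\<Sum>c\<le>Suc q. \<Sum>a\<in>compositions k (Suc q - c).
        1 / fact c * (2 * Gamma (s + of_nat c) * T0 (map Suc a) (s + of_nat c))))"
  (is "_ = _ * ?V")
proof -
  let ?\<tau> = "\<lambda>j. (- 2) ^ j * (\<Sum>n. ath_coeff ((Suc k - j) # replicate q 1) n) :: real"
  define g where "g w l t = indicator {0<..} t *\<^sub>R
       (of_real t powr (w - 1) * complex_of_real (ath_real (rev l) (exp (- t)) / sinh t))"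
    for w l and t :: real
  have g: "has_bochner_integral lborel (g w l) (2 * Gamma w * T0 l w)"
    if "\<forall>k\<in>set l. k \<ge> 1" "Re w > 1" for w l
    unfolding g_def[abs_def] by (rule has_bochner_integral_ath_real[OF that])
  have "has_bochner_integral lborel
     (\<lambda>t. (\<Sum>j<k. of_real (?\<tau> j) * g s (replicate j 1) t) +
        (- 2) ^ k / 2 ^ Suc q * (\<Sum>c\<le>Suc q. \<Sum>a\<in>compositions k (Suc q - c).
           1 / fact c * g (s + of_nat c) (map Suc a) t)) ?V"
    by (intro has_bochner_integral_add has_bochner_integral_sum has_bochner_integral_mult_right g)
      (use assms in auto)
  moreover have "(\<Sum>j<k. of_real (?\<tau> j) * g s (replicate j 1) t) +
        (- 2) ^ k / 2 ^ Suc q * (\<Sum>c\<le>Suc q. \<Sum>a\<in>compositions k (Suc q - c).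
           1 / fact c * g (s + of_nat c) (map Suc a) t) =
      indicator {0<..} t *\<^sub>R (of_real t powr (s - 1) *
        (Ath (map int (replicate q 1 @ [Suc k])) (of_real (tanh (t / 2))) / of_real (sinh t)))" for t
  proof (cases "t > 0")
    case True
    define p where "p = complex_of_real t powr (s - 1) / of_real (sinh t)"
    have g1: "g s (replicate j 1) t = p * of_real (ath_real (replicate j 1) (exp (- t)))" for j
      using True by (simp add: g_def p_def)
    have "of_real t powr (s + of_nat c - 1) = complex_of_real t powr (s - 1) * of_real t ^ c" for c
    proof -
      have "of_real t powr (s + of_nat c - 1) = complex_of_real t powr ((s - 1) + of_nat c)"
        by (simp add: algebra_simps)
      also have "\<dots> = complex_of_real t powr (s - 1) * of_real t powr of_nat c"
        by (rule powr_add)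
      finally show ?thesis using True by (simp add: powr_nat')
    qed
    then have g2: "g (s + of_nat c) (map Suc a) t =
        p * of_real (t ^ c * ath_real (rev (map Suc a)) (exp (- t)))" for c a
      using True by (simp add: g_def p_def)
    have "Ath (map int (replicate q 1 @ [Suc k])) (of_real (tanh (t / 2))) =
        of_real (ath_real (Suc k # replicate q 1) (tanh (t / 2)))"
      using Ath_of_real[of "replicate q 1 @ [Suc k]" "tanh (t / 2)"] tanh_half_bounds[of t] by simp
    also have "\<dots> = of_real ((\<Sum>j<k. ?\<tau> j * ath_real (replicate j 1) (exp (- t))) +
        (- 2) ^ k / 2 ^ Suc q * (\<Sum>c\<le>Suc q. \<Sum>a\<in>compositions k (Suc q - c).
           1 / fact c * (t ^ c * ath_real (rev (map Suc a)) (exp (- t)))))"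
      unfolding ath_real_tanh_expansion[OF True] comp_remainder_def ath_comp_def
      by (simp add: sum_distrib_left)
    finally have Ath: "Ath (map int (replicate q 1 @ [Suc k])) (of_real (tanh (t / 2))) = \<dots>" .
    show ?thesis
      unfolding Ath g1 g2 using True
      by (simp add: p_def sum_distrib_left sum_distrib_right algebra_simps add_divide_distrib sum_divide_distrib)
  qed (simp add: g_def)
  ultimately have "has_bochner_integral lborel (\<lambda>t. indicator {0<..} t *\<^sub>R (of_real t powr (s - 1) *
        (Ath (map int (replicate q 1 @ [Suc k])) (of_real (tanh (t / 2))) / of_real (sinh t)))) ?V"
    by simp
  then show ?thesis
    unfolding psi_def set_lebesgue_integral_def
    by (simp only: has_bochner_integral_integral_eq) simp
qed

theorem theorem5p5:
  fixes r k :: nat and s :: complex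
  assumes "r \<ge> 1" and "k \<ge> 1" and "Re s > 1"
  shows "psi (replicate (r - 1) 1 @ [k]) s =
    (- 1) ^ (k - 1) *
      (\<Sum>a\<in>{a :: nat list. length a = k \<and> sum_list a = r}.
         ((s + of_nat (last a) - 1) gchoose last a) *
         T (map (\<lambda>i. i + 1) (butlast a)) (of_nat (last a) + s)) +
    (\<Sum>j<k - 1. (- 1) ^ j *
         T (replicate (r - 1) 1) (of_nat (k - j)) * T (replicate j 1) s)"
proof -
  obtain q k' where qk: "r = Suc q" "k = Suc k'"
    using assms by (metis Suc_le_D One_nat_def)
  have G: "Gamma s \<noteq> 0"
    using assms by (intro Gamma_nonzero) (auto simp: complex_nonpos_Reals_iff elim!: nonpos_Ints_cases)
  \<comment> \<open>The powers of 2 regroup as \<open>2 ^ Suc q\<close> and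
    \<open>2 ^ Suc j\<close>, the normalisations of the two \<open>T\<close> factors.\<close>
  have first: "2 ^ Suc q / Gamma s * (of_real ((- 2) ^ j * (\<Sum>n. ath_coeff ((Suc k' - j) # replicate q 1) n)) *
        (2 * Gamma s * T0 (replicate j 1) s)) =
      (- 1) ^ j * T (replicate q 1) (of_nat (Suc k' - j)) * T (replicate j 1) s" if "j < k'" for j
  proof -
    have "(- 2) ^ j = (- 1) ^ j * (2 :: complex) ^ j"
      by (simp add: power_mult_distrib[symmetric])
    moreover have "T0 (replicate q 1) (of_nat (Suc k' - j)) =
        of_real (\<Sum>n. ath_coeff ((Suc k' - j) # replicate q 1) n)"
      using that T0_of_nat[of "replicate q 1" "Suc k' - j"] by simp
    ultimately show ?thesis
      using G by (simp add: T_def del: of_nat_diff)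
  qed
  \<comment> \<open>The quotient \<open>Gamma (s + c) / Gamma s\<close> is a rising factorial, and
    with \<open>1 / fact c\<close> it becomes the binomial coefficient. The powers of 2 left over
    are \<open>2 ^ Suc k'\<close>, matching depth \<open>k\<close>.\<close>
  have second: "2 ^ Suc q / Gamma s * ((- 2) ^ k' / 2 ^ Suc q *
        (1 / fact c * (2 * Gamma (s + of_nat c) * T0 (map Suc a) (s + of_nat c)))) =
      (- 1) ^ k' * (((s + of_nat c - 1) gchoose c) * T (map Suc a) (of_nat c + s))"
    if "length a = k'" for c a
  proof -
    have "s \<notin> \<int>\<^sub>\<le>\<^sub>0"
      using assms by (auto elim!: nonpos_Ints_cases)
    then have "Gamma (s + of_nat c) = pochhammer s c * Gamma s"
      using pochhammer_Gamma[of s c] G by simp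
    moreover have "(s + of_nat c - 1) gchoose c = pochhammer s c / fact c"
      by (simp add: gbinomial_pochhammer')
    moreover have "(- 2) ^ k' = (- 1) ^ k' * (2 :: complex) ^ k'"
      by (simp add: power_mult_distrib[symmetric])
    ultimately show ?thesis
      using G that by (simp add: T_def add.commute)
  qed
  have "psi (replicate q 1 @ [Suc k']) s =
      (\<Sum>j<k'. (- 1) ^ j * T (replicate q 1) (of_nat (Suc k' - j)) * T (replicate j 1) s) +
      (\<Sum>c\<le>Suc q. \<Sum>a\<in>compositions k' (Suc q - c).
        (- 1) ^ k' * (((s + of_nat c - 1) gchoose c) * T (map Suc a) (of_nat c + s)))"
    unfolding psi_eq[OF assms(3)] distrib_left sum_distrib_left
    by (intro arg_cong2[of _ _ _ _ "(+)"] sum.cong refl first second)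
      (auto simp: compositions_def)
  \<comment> \<open>The power \<open>c\<close> of \<open>t\<close> becomes the last part of a
    composition into \<open>Suc k'\<close> parts.\<close>
  also have "(\<Sum>c\<le>Suc q. \<Sum>a\<in>compositions k' (Suc q - c).
        (- 1) ^ k' * (((s + of_nat c - 1) gchoose c) * T (map Suc a) (of_nat c + s))) =
      (- 1) ^ k' * (\<Sum>a\<in>compositions (Suc k') (Suc q).
         ((s + of_nat (last a) - 1) gchoose last a) * T (map Suc (butlast a)) (of_nat (last a) + s))"
    by (simp only: sum_compositions_Suc sum_distrib_left last_snoc butlast_snoc)
  finally show ?thesis
    by (simp add: qk compositions_def add.commute)
qed

end
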